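(* Let $H$ be a countable group and let $\mu$ be a non-degenerate probability measure on $\mathsf{Shuffler}(H)=\mathrm{FSym}(H)\rtimes H$ that induces a transient random walk on $H$, and such that $\mathbb{E}(|\mathrm{supp}(\sigma_1)|)=\sum_{(f,y)\in\mathsf{Shuffler}(H)}|\mathrm{supp}(f)|\,\mu(f,y)<\infty$, where $\sigma_1$ denotes the $\mathrm{FSym}(H)$-component of a $\mu$-distributed increment. Then the Poisson boundary of $(\mathsf{Shuffler}(H),\mu)$ is non-trivial.
   Context: For a countable group $H$, $\mathrm{FSym}(H)$ is the group (under composition) of bijections $f:H\to H$ with finite support $\mathrm{supp}(f)=\{h\in H: f(h)\neq h\}$. $H$ acts on it by $(h\cdot f)(x)=hf(h^{-1}x)$, and $\mathsf{Shuffler}(H):=\mathrm{FSym}(H)\rtimes H$ with product $(f,x)(g,y)=(f\circ(x\cdot g),xy)$. A probability measure $\mu$ on a countable group $G$ is non-degenerate if its support generates $G$ as a semigroup. The $\mu$-random walk is $x_n=g_1\cdots g_n$ with $g_i$ i.i.d. of law $\mu$, started at $e_G$; $\mathbb{P}$ is the law of $(x_1,x_2,\dots)$ on $G^\infty$. The random walk induced on $H$ is driven by the push-forward of $\mu$ under the projection $\mathsf{Shuffler}(H)\to H$; it is transient if almost surely it visits $e_H$ only finitely many times. The Poisson boundary of $(G,\mu)$ is the space of ergodic components of the shift $T(x_1,x_2,\dots)=(x_2,x_3,\dots)$ on $(G^\infty,\mathbb{P})$; it is trivial if every shift-invariant event has $\mathbb{P}$-probability $0$ or $1$, and non-trivial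 otherwise. For non-degenerate $\mu$, non-triviality is equivalent to the existence of a non-constant bounded function $f:G\to\mathbb{R}$ with $f(g)=\sum_{h}f(gh)\mu(h)$ for all $g$. *)

theory Defs
  imports
    "HOL-Probability.Probability"
    "HOL-Algebra.Group"
    "HOL-Combinatorics.Permutations"
begin

section \<open>The shuffler group\<close>

definition supp :: "('a, 'b) monoid_scheme \<Rightarrow> ('a \<Rightarrow> 'a) \<Rightarrow> 'a set" where
  "supp H f = {h \<in> carrier H. f h \<noteq> h}"

text \<open>A bijection of \<open>H\<close> is represented by the total function that agrees with it on
  \<open>carrier H\<close> and is the identity elsewhere; this makes the representation unique.\<close>

definition FSym :: "('a, 'b) monoid_scheme \<Rightarrow> ('a \<Rightarrow> 'a) monoid" where
  "FSym H = \<lparr>carrier = {f. f permutes carrier H \<and> finite (supp H f)}, mult = (\<circ>), one = id\<rparr>"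

definition FSym_act :: "('a, 'b) monoid_scheme \<Rightarrow> 'a \<Rightarrow> ('a \<Rightarrow> 'a) \<Rightarrow> 'a \<Rightarrow> 'a" where
  "FSym_act H h f = (\<lambda>x. if x \<in> carrier H then h \<otimes>\<^bsub>H\<^esub> f (inv\<^bsub>H\<^esub> h \<otimes>\<^bsub>H\<^esub> x) else x)"

definition Shuffler :: "('a, 'b) monoid_scheme \<Rightarrow> (('a \<Rightarrow> 'a) \<times> 'a) monoid" where
  "Shuffler H = \<lparr>carrier = carrier (FSym H) \<times> carrier H,
     mult = (\<lambda>(f, x) (g, y). (f \<otimes>\<^bsub>FSym H\<^esub> FSym_act H x g, x \<otimes>\<^bsub>H\<^esub> y)),
     one = (\<one>\<^bsub>FSym H\<^esub>, \<one>\<^bsub>H\<^esub>)\<rparr>"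

lemma (in group) FSym_act_closed:
  assumes "h \<in> carrier G" "f \<in> carrier (FSym G)"
  shows "FSym_act G h f \<in> carrier (FSym G)"
proof -
  have f: "f permutes carrier G" "finite (supp G f)"
    using assms(2) by (auto simp: FSym_def)
  have fc: "f x \<in> carrier G" if "x \<in> carrier G" for x
    using f(1) that by (simp add: permutes_in_image)
  have "bij_betw (FSym_act G h f) (carrier G) (carrier G)"
  proof (rule bij_betwI[where g = "FSym_act G h (inv_into UNIV f)"])
    have ic: "inv_into UNIV f x \<in> carrier G" if "x \<in> carrier G" for x
      using permutes_inv[OF f(1)] that by (simp add: permutes_in_image)
    show "FSym_act G h f \<in> carrier G \<rightarrow> carrier G" "FSym_act G h (inv_into UNIV f) \<in> carrier G \<rightarrow> carrier G"
      using assms(1) fc ic by (auto simp: FSym_act_def)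
    show "FSym_act G h (inv_into UNIV f) (FSym_act G h f x) = x" if "x \<in> carrier G" for x
      using assms(1) fc ic that permutes_inverses[OF f(1)] by (simp add: FSym_act_def m_assoc[symmetric])
    show "FSym_act G h f (FSym_act G h (inv_into UNIV f) x) = x" if "x \<in> carrier G" for x
      using assms(1) fc ic that permutes_inverses[OF f(1)] by (simp add: FSym_act_def m_assoc[symmetric])
  qed
  then have 1: "FSym_act G h f permutes carrier G"
    by (rule bij_imp_permutes) (simp add: FSym_act_def)
  have "supp G (FSym_act G h f) \<subseteq> (\<lambda>x. h \<otimes> x) ` supp G f"
  proof
    fix x assume x: "x \<in> supp G (FSym_act G h f)"
    then have xc: "x \<in> carrier G" "h \<otimes> f (inv h \<otimes> x) \<noteq> x" by (auto simp: supp_def FSym_act_def)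
    have e: "x = h \<otimes> (inv h \<otimes> x)" using xc assms(1) by (simp add: m_assoc[symmetric])
    then have "inv h \<otimes> x \<in> supp G f" using xc assms(1) by (auto simp: supp_def)
    with e show "x \<in> (\<lambda>x. h \<otimes> x) ` supp G f" by blast
  qed
  then have "finite (supp G (FSym_act G h f))" using f(2) finite_surj by blast
  with 1 show ?thesis by (simp add: FSym_def)
qed

lemma group_FSym: "group (FSym H)"
proof (rule groupI)
  fix f g assume "f \<in> carrier (FSym H)" "g \<in> carrier (FSym H)"
  then have f: "f permutes carrier H" "finite (supp H f)" "g permutes carrier H" "finite (supp H g)"
    by (auto simp: FSym_def)
  have "supp H (f \<circ> g) \<subseteq> supp H f \<union> supp H g" by (auto simp: supp_def)
  then have "finite (supp H (f \<circ> g))" using f finite_subset by blast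
  then show "f \<otimes>\<^bsub>FSym H\<^esub> g \<in> carrier (FSym H)"
    using permutes_compose[OF f(3) f(1)] by (simp add: FSym_def)
next
  fix f assume "f \<in> carrier (FSym H)"
  then have f: "f permutes carrier H" "finite (supp H f)" by (auto simp: FSym_def)
  have "supp H (inv_into UNIV f) \<subseteq> supp H f"
    by (auto simp: supp_def permutes_inv_eq[OF f(1)])
  then have "finite (supp H (inv_into UNIV f))" using f finite_subset by blast
  then show "\<exists>g\<in>carrier (FSym H). g \<otimes>\<^bsub>FSym H\<^esub> f = \<one>\<^bsub>FSym H\<^esub>"
    using permutes_inv[OF f(1)] permutes_inv_o(2)[OF f(1)] by (auto simp: FSym_def)
qed (auto simp: FSym_def permutes_id supp_def comp_assoc)

lemma group_Shuffler:
  assumes "group H" shows "group (Shuffler H)"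
proof -
  interpret H: group H by fact
  interpret F: group "FSym H" by (rule group_FSym)
  have c: "f x \<in> carrier H" if "f \<in> carrier (FSym H)" "x \<in> carrier H" for f x
    using that by (auto simp: FSym_def permutes_in_image)
  have o: "f x = x" if "f \<in> carrier (FSym H)" "x \<notin> carrier H" for f x
    using that by (auto simp: FSym_def permutes_not_in)
  have m: "f \<otimes>\<^bsub>FSym H\<^esub> g = f \<circ> g" "\<one>\<^bsub>FSym H\<^esub> = id" for f g by (auto simp: FSym_def)
  have act_mult: "FSym_act H x (f \<otimes>\<^bsub>FSym H\<^esub> g) = FSym_act H x f \<otimes>\<^bsub>FSym H\<^esub> FSym_act H x g"
    if "x \<in> carrier H" "f \<in> carrier (FSym H)" "g \<in> carrier (FSym H)" for x f g
    using that c by (auto simp: FSym_act_def m fun_eq_iff H.m_assoc[symmetric])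
  have act_act: "FSym_act H x (FSym_act H y f) = FSym_act H (x \<otimes>\<^bsub>H\<^esub> y) f"
    if "x \<in> carrier H" "y \<in> carrier H" "f \<in> carrier (FSym H)" for x y f
    using that c by (auto simp: FSym_act_def fun_eq_iff H.m_assoc H.inv_mult_group)
  have act_one: "FSym_act H \<one>\<^bsub>H\<^esub> f = f" if "f \<in> carrier (FSym H)" for f
    using c[OF that] o[OF that] by (simp add: FSym_act_def fun_eq_iff)
  have act_id: "FSym_act H x (\<one>\<^bsub>FSym H\<^esub>) = \<one>\<^bsub>FSym H\<^esub>" if "x \<in> carrier H" for x
    using that by (auto simp: FSym_act_def m fun_eq_iff H.m_assoc[symmetric])
  show ?thesis
  proof (rule groupI)
    fix p assume p: "p \<in> carrier (Shuffler H)"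
    obtain f x where [simp]: "p = (f, x)" by (cases p)
    from p have f: "f \<in> carrier (FSym H)" and x: "x \<in> carrier H" by (auto simp: Shuffler_def)
    let ?q = "(FSym_act H (inv\<^bsub>H\<^esub> x) (inv\<^bsub>FSym H\<^esub> f), inv\<^bsub>H\<^esub> x)"
    have "?q \<in> carrier (Shuffler H)"
      using f x H.FSym_act_closed by (auto simp: Shuffler_def)
    moreover have "?q \<otimes>\<^bsub>Shuffler H\<^esub> p = \<one>\<^bsub>Shuffler H\<^esub>"
      using f x by (simp add: Shuffler_def act_mult[symmetric] act_id)
    ultimately show "\<exists>q\<in>carrier (Shuffler H). q \<otimes>\<^bsub>Shuffler H\<^esub> p = \<one>\<^bsub>Shuffler H\<^esub>" by blast
  qed (auto simp: Shuffler_def H.FSym_act_closed act_mult act_act act_one F.m_assoc H.m_assoc)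
qed

lemma countable_Shuffler:
  assumes "countable (carrier H)" shows "countable (carrier (Shuffler H))"
proof -
  let ?g = "\<lambda>f. (\<lambda>x. (x, f x)) ` supp H f"
  have inj: "inj_on ?g (carrier (FSym H))"
  proof (rule inj_onI, rule ext)
    fix f g x assume f: "f \<in> carrier (FSym H)" "g \<in> carrier (FSym H)" and e: "?g f = ?g g"
    have out: "f x = x" "g x = x" if "x \<notin> carrier H" using f that by (auto simp: FSym_def permutes_not_in)
    have s: "supp H f = supp H g" using arg_cong[OF e, of "image fst"] by (simp add: image_image)
    show "f x = g x"
    proof (cases "x \<in> supp H f")
      case True then have "(x, f x) \<in> ?g g" using e by blast
      then show ?thesis by auto
    next
      case False
      then have "x \<notin> supp H g" using s by blast
      with False have "f x = x" "g x = x" using out unfolding supp_def by blast+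
      then show ?thesis by metis
    qed
  qed
  have "?g ` carrier (FSym H) \<subseteq> {A. A \<subseteq> carrier H \<times> carrier H \<and> finite A}"
    by (auto simp: FSym_def supp_def permutes_in_image)
  moreover have "countable {A. A \<subseteq> carrier H \<times> carrier H \<and> finite A}"
    using countable_Collect_finite_subset[of "carrier H \<times> carrier H"] assms
    by (simp add: conj_commute[of "_ \<subseteq> _"])
  ultimately have "countable (?g ` carrier (FSym H))" by (rule countable_subset)
  then have "countable (carrier (FSym H))" using inj by (rule countable_image_inj_on)
  then show ?thesis using assms by (simp add: Shuffler_def)
qed

section \<open>Random walks on countable groups\<close>

text \<open>A probability measure on a countable group \<open>G\<close> is a probability space \<open>M\<close> with
  \<open>sets M = Pow (carrier G)\<close>.\<close>

definition prob_measure_on :: "('a, 'b) monoid_scheme \<Rightarrow> 'a measure \<Rightarrow> bool" where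
  "prob_measure_on G M \<longleftrightarrow> prob_space M \<and> sets M = Pow (carrier G)"

definition msupport :: "'a measure \<Rightarrow> 'a set" where
  "msupport M = {x \<in> space M. measure M {x} > 0}"

inductive_set semigroup_span :: "('a, 'b) monoid_scheme \<Rightarrow> 'a set \<Rightarrow> 'a set"
  for G :: "('a, 'b) monoid_scheme" and S :: "'a set" where
  base: "x \<in> S \<Longrightarrow> x \<in> semigroup_span G S"
| mult: "x \<in> semigroup_span G S \<Longrightarrow> y \<in> semigroup_span G S \<Longrightarrow> x \<otimes>\<^bsub>G\<^esub> y \<in> semigroup_span G S"

definition nondegenerate :: "('a, 'b) monoid_scheme \<Rightarrow> 'a measure \<Rightarrow> bool" where
  "nondegenerate G M \<longleftrightarrow> semigroup_span G (msupport M) = carrier G"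

text \<open>Sequences are indexed from \<open>0\<close>: \<open>g n\<close> is the increment \<open>g\<^sub>n\<^sub>+\<^sub>1\<close>, and \<open>walk G g n\<close> is
  the position \<open>x\<^sub>n\<^sub>+\<^sub>1 = g\<^sub>1 \<cdots> g\<^sub>n\<^sub>+\<^sub>1\<close>.\<close>

primrec walk :: "('a, 'b) monoid_scheme \<Rightarrow> (nat \<Rightarrow> 'a) \<Rightarrow> nat \<Rightarrow> 'a" where
  "walk G g 0 = g 0"
| "walk G g (Suc n) = walk G g n \<otimes>\<^bsub>G\<^esub> g (Suc n)"

definition path_space :: "('a, 'b) monoid_scheme \<Rightarrow> (nat \<Rightarrow> 'a) measure" where
  "path_space G = Pi\<^sub>M UNIV (\<lambda>_. count_space (carrier G))"

definition walk_law :: "('a, 'b) monoid_scheme \<Rightarrow> 'a measure \<Rightarrow> (nat \<Rightarrow> 'a) measure" where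
  "walk_law G M = distr (Pi\<^sub>M UNIV (\<lambda>_. M)) (path_space G) (walk G)"

definition transient_walk :: "('a, 'b) monoid_scheme \<Rightarrow> 'a measure \<Rightarrow> bool" where
  "transient_walk G M \<longleftrightarrow> (AE x in walk_law G M. finite {n. x n = \<one>\<^bsub>G\<^esub>})"

definition shift :: "(nat \<Rightarrow> 'a) \<Rightarrow> nat \<Rightarrow> 'a" where
  "shift x = (\<lambda>n. x (Suc n))"

definition shift_invariant_events :: "('a, 'b) monoid_scheme \<Rightarrow> (nat \<Rightarrow> 'a) set set" where
  "shift_invariant_events G =
     {A \<in> sets (path_space G). shift -` A \<inter> space (path_space G) = A}"

text \<open>Events are invariant in the strict sense \<open>T\<^sup>-\<^sup>1 A = A\<close>: the shift \<open>T\<close> need not be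
  non-singular with respect to the law of the walk.\<close>

definition trivial_Poisson_boundary :: "('a, 'b) monoid_scheme \<Rightarrow> 'a measure \<Rightarrow> bool" where
  "trivial_Poisson_boundary G M \<longleftrightarrow>
     (\<forall>A \<in> shift_invariant_events G. measure (walk_law G M) A = 0 \<or> measure (walk_law G M) A = 1)"

definition induced_measure ::
    "('a, 'b) monoid_scheme \<Rightarrow> (('a \<Rightarrow> 'a) \<times> 'a) measure \<Rightarrow> 'a measure" where
  "induced_measure H \<mu> = distr \<mu> (count_space (carrier H)) snd"

text \<open>Push-forwards are taken with \<open>distr\<close>, which is only meaningful for measurable maps.
  Measurability of \<open>walk G\<close> relies on \<open>carrier G\<close> being countable.\<close>

lemma walk_measurable:
  assumes "group G" "countable (carrier G)" "prob_measure_on G M"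
  shows "walk G \<in> measurable (Pi\<^sub>M UNIV (\<lambda>_. M)) (path_space G)"
proof -
  interpret G: group G by fact
  have [measurable_cong]: "sets M = sets (count_space (carrier G))"
    using assms(3) by (simp add: prob_measure_on_def)
  have w: "(\<lambda>g. walk G g n) \<in> measurable (Pi\<^sub>M UNIV (\<lambda>_. M)) (count_space (carrier G))" for n
  proof (induction n)
    case 0
    show ?case by simp
  next
    case (Suc n)
    have "(\<lambda>p. fst p \<otimes>\<^bsub>G\<^esub> snd p) \<in> measurable (count_space (carrier G) \<Otimes>\<^sub>M count_space (carrier G)) (count_space (carrier G))"
      using assms(2) by (subst pair_measure_countable) auto
    then have "(\<lambda>g. (\<lambda>p. fst p \<otimes>\<^bsub>G\<^esub> snd p) (walk G g n, g (Suc n))) \<in> measurable (Pi\<^sub>M UNIV (\<lambda>_. M)) (count_space (carrier G))"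
      by (rule measurable_compose[rotated]) (use Suc in measurable)
    then show ?case by simp
  qed
  show ?thesis unfolding path_space_def
    by (rule measurable_PiM_single'[OF w]) (auto dest: measurable_space[OF w])
qed

lemma prob_space_walk_law:
  assumes "group G" "countable (carrier G)" "prob_measure_on G M"
  shows "prob_space (walk_law G M)"
proof -
  have "prob_space (Pi\<^sub>M UNIV (\<lambda>_. M))"
    using assms(3) by (auto intro: prob_space_PiM simp: prob_measure_on_def)
  then show ?thesis unfolding walk_law_def
    using walk_measurable[OF assms] by (rule prob_space.prob_space_distr)
qed

lemma prob_measure_on_induced_measure:
  assumes "prob_measure_on (Shuffler H) \<mu>"
  shows "prob_measure_on H (induced_measure H \<mu>)"
proof -
  have s: "sets \<mu> = sets (count_space (carrier (Shuffler H)))" "prob_space \<mu>"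
    using assms by (simp_all add: prob_measure_on_def)
  have "snd \<in> measurable \<mu> (count_space (carrier H))"
    by (subst measurable_cong_sets[OF s(1) refl]) (auto simp: Shuffler_def)
  then show ?thesis
    using s(2) by (simp add: prob_measure_on_def induced_measure_def prob_space.prob_space_distr)
qed

end

theory Submission
  imports Defs
begin

text \<open>Write the walk as \<open>(F\<^sub>n, Y\<^sub>n)\<close>. For fixed \<open>h\<close>, the value \<open>F\<^sub>n h\<close> changes at step \<open>n + 1\<close> only
  if \<open>Y\<^sub>n = h s\<^sup>-\<^sup>1\<close> for some \<open>s\<close> in the support of the new permutation. The Green function of
  the transient walk \<open>Y\<^sub>n\<close> is bounded, so the expected number of such times is at most a multiple
  of the expected support size, and \<open>F\<^sub>n\<close> converges pointwise almost surely. If the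
  Poisson boundary were trivial, the limit \<open>\<phi>\<close> would be deterministic; then \<open>\<phi> = f \<circ> (y \<cdot> \<phi>)\<close> for all
  \<open>(f, y)\<close> in the support of \<open>\<mu>\<close>, hence for the whole group, which fails when \<open>y\<close> is trivial and
  \<open>f\<close> moves \<open>\<phi> 1\<close>.\<close>

section \<open>Independence of past and future increments\<close>

context sequence_space
begin

text \<open>\<open>comb_seq n\<close> splices the first \<open>n\<close> entries of one sequence
  with a second sequence and maps \<open>S \<Otimes>\<^sub>M S\<close> onto \<open>S\<close>. An
  event whose preimage is a rectangle therefore has product measure: independence of past and future
  without auxiliary sigma-algebras.\<close>

lemma emeasure_comb_seq:
  assumes E: "E \<in> sets S" and A: "A \<in> sets S" and B: "B \<in> sets S"
    and iff: "\<And>\<omega> \<omega>'. \<omega> \<in> space S \<Longrightarrow> \<omega>' \<in> space S \<Longrightarrow> comb_seq n \<omega> \<omega>' \<in> E \<longleftrightarrow> \<omega> \<in> A \<and> \<omega>' \<in> B"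
  shows "emeasure S E = emeasure S A * emeasure S B"
proof -
  have "emeasure S E = emeasure (distr (S \<Otimes>\<^sub>M S) S (\<lambda>(\<omega>, \<omega>'). comb_seq n \<omega> \<omega>')) E"
    by (simp only: PiM_comb_seq)
  also have "\<dots> = emeasure (S \<Otimes>\<^sub>M S)
      ((\<lambda>(\<omega>, \<omega>'). comb_seq n \<omega> \<omega>') -` E \<inter> space (S \<Otimes>\<^sub>M S))"
    by (rule emeasure_distr[OF measurable_comb_seq E])
  also have "(\<lambda>(\<omega>, \<omega>'). comb_seq n \<omega> \<omega>') -` E \<inter> space (S \<Otimes>\<^sub>M S) = A \<times> B"
    using iff A[THEN sets.sets_into_space, THEN subsetD] B[THEN sets.sets_into_space, THEN subsetD]
    by (fastforce simp: space_pair_measure)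
  also have "emeasure (S \<Otimes>\<^sub>M S) (A \<times> B) = emeasure S A * emeasure S B"
    using A B by (rule P.emeasure_pair_measure_Times)
  finally show ?thesis .
qed

text \<open>Here \<open>shift\<close> acts on increments, where reindexing along the injection
  \<open>Suc\<close> preserves the product measure. This gives the almost sure limit also for the
  walk without its first increment.\<close>

lemma AE_shift:
  assumes "AE \<omega> in S. P \<omega>"
  shows "AE \<omega> in S. P (shift \<omega>)"
proof -
  have "distr S S (\<lambda>\<omega>. \<lambda>n\<in>UNIV. \<omega> (Suc n)) = S"
    by (rule distr_PiM_reindex[of UNIV "\<lambda>_. M" Suc UNIV]) (auto simp: prob_space)
  then have "distr S S shift = S"
    by (simp add: shift_def[abs_def] restrict_def)
  moreover have "shift \<in> measurable S S"
    unfolding shift_def[abs_def] by (intro measurable_PiM_single') (auto simp: space_PiM)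
  ultimately show ?thesis
    using AE_distrD assms by metis
qed

end

text \<open>Checked on cylinder sets, whose preimages are again cylinders. It identifies the
  projected increments with independent increments of the induced law.\<close>

lemma distr_PiM_UNIV:
  assumes M: "prob_space M" and f[measurable]: "f \<in> measurable M N"
  shows "distr (Pi\<^sub>M (UNIV :: nat set) (\<lambda>_. M)) (Pi\<^sub>M UNIV (\<lambda>_. distr M N f)) (\<lambda>\<omega> n. f (\<omega> n))
    = Pi\<^sub>M UNIV (\<lambda>_. distr M N f)"
proof -
  interpret M: product_prob_space "\<lambda>_. M" "UNIV :: nat set"
    using M by (intro product_prob_spaceI)
  interpret N: product_prob_space "\<lambda>_. distr M N f" "UNIV :: nat set"
    using M by (intro product_prob_spaceI prob_space.prob_space_distr f)
  have m: "(\<lambda>\<omega> n. f (\<omega> n)) \<in> measurable (Pi\<^sub>M UNIV (\<lambda>_. M)) (Pi\<^sub>M UNIV (\<lambda>_. distr M N f))"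
    by (intro measurable_PiM_single') (auto simp: space_PiM dest: measurable_space[OF f])
  show ?thesis
  proof (rule N.PiM_eq)
    fix J and F :: "nat \<Rightarrow> 'b set"
    assume J: "finite J" and F: "\<And>j. j \<in> J \<Longrightarrow> F j \<in> sets (distr M N f)"
    have "(\<lambda>\<omega> n. f (\<omega> n)) -` prod_emb UNIV (\<lambda>_. distr M N f) J (Pi\<^sub>E J F) \<inter> space (Pi\<^sub>M UNIV (\<lambda>_. M))
      = prod_emb UNIV (\<lambda>_. M) J (\<Pi>\<^sub>E j\<in>J. f -` F j \<inter> space M)"
      using measurable_space[OF f] by (auto simp: prod_emb_def space_PiM PiE_iff)
    then have "emeasure (distr (Pi\<^sub>M UNIV (\<lambda>_. M)) (Pi\<^sub>M UNIV (\<lambda>_. distr M N f)) (\<lambda>\<omega> n. f (\<omega> n)))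
        (prod_emb UNIV (\<lambda>_. distr M N f) J (Pi\<^sub>E J F))
      = (\<Prod>j\<in>J. emeasure M (f -` F j \<inter> space M))"
      using J F by (subst emeasure_distr[OF m]) (auto intro!: M.emeasure_PiM_emb measurable_sets[OF f])
    then show "emeasure (distr (Pi\<^sub>M UNIV (\<lambda>_. M)) (Pi\<^sub>M UNIV (\<lambda>_. distr M N f)) (\<lambda>\<omega> n. f (\<omega> n)))
        (prod_emb UNIV (\<lambda>_. distr M N f) J (Pi\<^sub>E J F)) = (\<Prod>j\<in>J. emeasure (distr M N f) (F j))"
      using F by (simp add: emeasure_distr[OF f])
  qed simp
qed

section \<open>Random walks\<close>

text \<open>Unlike \<open>walk\<close>, this starts with the empty product, so the position at time
  \<open>n\<close> depends on exactly the increments with index below \<open>n\<close>.\<close>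

primrec pos :: "('a, 'b) monoid_scheme \<Rightarrow> (nat \<Rightarrow> 'a) \<Rightarrow> nat \<Rightarrow> 'a" where
  "pos G \<omega> 0 = \<one>\<^bsub>G\<^esub>"
| "pos G \<omega> (Suc n) = pos G \<omega> n \<otimes>\<^bsub>G\<^esub> \<omega> n"

lemma pos_cong: "(\<And>i. i < n \<Longrightarrow> \<omega> i = \<omega>' i) \<Longrightarrow> pos G \<omega> n = pos G \<omega>' n"
  by (induction n) auto

locale random_walk = group G for G (structure) +
  fixes M :: "'a measure"
  assumes countable_carrier: "countable (carrier G)"
    and prob_measure: "prob_measure_on G M"
begin

lemma sets_M: "sets M = Pow (carrier G)"
  using prob_measure by (simp add: prob_measure_on_def)

lemma space_M: "space M = carrier G"
  using sets_eq_imp_space_eq[of M "count_space (carrier G)"] by (simp add: sets_M)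

sublocale sequence_space M
  unfolding sequence_space_def
  using prob_measure by (intro product_prob_spaceI) (simp add: prob_measure_on_def)

lemma in_carrier: "\<omega> \<in> space S \<Longrightarrow> \<omega> n \<in> carrier G"
  by (auto simp: space_PiM space_M PiE_iff)

lemma pos_closed: "(\<And>n. \<omega> n \<in> carrier G) \<Longrightarrow> pos G \<omega> n \<in> carrier G"
  by (induction n) auto

lemma pos_add:
  assumes "\<And>n. \<omega> n \<in> carrier G"
  shows "pos G \<omega> (n + m) = pos G \<omega> n \<otimes> pos G (\<lambda>i. \<omega> (n + i)) m"
  using assms by (induction m) (auto simp: pos_closed m_assoc)

lemma pos_Suc_shift:
  assumes "\<And>n. \<omega> n \<in> carrier G"
  shows "pos G \<omega> (Suc n) = \<omega> 0 \<otimes> pos G (shift \<omega>) n"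
  using pos_add[of \<omega> 1 n] assms by (simp add: shift_def)

lemma walk_eq_pos:
  assumes "\<And>n. \<omega> n \<in> carrier G"
  shows "walk G \<omega> n = pos G \<omega> (Suc n)"
  using assms by (induction n) auto

lemma measurable_M: "measurable M N = measurable (count_space (carrier G)) N"
  by (intro measurable_cong_sets) (simp_all add: sets_M)

lemma measurable_count_space_M: "measurable N M = measurable N (count_space (carrier G))"
  by (intro measurable_cong_sets) (simp_all add: sets_M)

lemma increment_measurable [measurable]: "(\<lambda>\<omega>. \<omega> n) \<in> measurable S (count_space (carrier G))"
  unfolding measurable_count_space_M[symmetric] by measurable

lemma pos_measurable [measurable]: "(\<lambda>\<omega>. pos G \<omega> n) \<in> measurable S (count_space (carrier G))"
proof (cases n)
  case 0
  then show ?thesis by simp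
next
  case (Suc m)
  have "(\<lambda>\<omega>. walk G \<omega> m) \<in> measurable S (count_space (carrier G))"
    using walk_measurable[OF is_group countable_carrier prob_measure] unfolding path_space_def
    by (rule measurable_compose[OF _ measurable_component_singleton]) simp
  then show ?thesis
    by (rule measurable_cong[THEN iffD1, rotated]) (simp add: Suc walk_eq_pos in_carrier)
qed

text \<open>The algebraic form of the Markov property: after time \<open>n\<close> the spliced walk
  is a fresh walk translated by the position reached.\<close>

lemma pos_comb_seq:
  assumes "\<omega> \<in> space S" "\<omega>' \<in> space S"
  shows "pos G (comb_seq n \<omega> \<omega>') n = pos G \<omega> n"
    and "pos G (comb_seq n \<omega> \<omega>') (n + m) = pos G \<omega> n \<otimes> pos G \<omega>' m"
proof -
  show 1: "pos G (comb_seq n \<omega> \<omega>') n = pos G \<omega> n"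
    by (rule pos_cong) (simp add: comb_seq_less)
  have "comb_seq n \<omega> \<omega>' i \<in> carrier G" for i
    using assms by (simp add: comb_seq_def in_carrier)
  then show "pos G (comb_seq n \<omega> \<omega>') (n + m) = pos G \<omega> n \<otimes> pos G \<omega>' m"
    by (subst pos_add) (auto simp: 1 comb_seq_add[of n \<omega> \<omega>', unfolded add.commute[of _ n]])
qed

lemma walk_in_measurable: "walk G \<in> measurable S (path_space G)"
  by (rule walk_measurable[OF is_group countable_carrier prob_measure])

text \<open>Moves almost sure statements from paths to increments; the \<open>Suc\<close> appears
  because path coordinate \<open>n\<close> is the position after \<open>n + 1\<close>
  increments.\<close>

lemma AE_walk_lawD:
  assumes "AE x in walk_law G M. P x"
  shows "AE \<omega> in S. P (\<lambda>n. pos G \<omega> (Suc n))"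
proof -
  have "AE \<omega> in S. P (walk G \<omega>)"
    using assms unfolding walk_law_def by (rule AE_distrD[OF walk_in_measurable])
  then show ?thesis
    by (rule AE_mp) (auto intro!: AE_I2 simp: ext[OF walk_eq_pos] in_carrier simp del: pos.simps)
qed

text \<open>The last visit to \<open>k\<close> happens at a given time \<open>n\<close> with probability \<open>P(x\<^sub>n = k) q\<close>, where
  \<open>q\<close> is the probability of never returning to the identity, and these events are disjoint.
  For \<open>k\<close> the identity they cover almost everything, so \<open>q > 0\<close>.\<close>

lemma transient_Green_bound:
  assumes "transient_walk G M"
  obtains C :: ennreal where "C < \<infinity>"
    "\<And>k. k \<in> carrier G \<Longrightarrow> (\<Sum>n. emeasure S {\<omega> \<in> space S. pos G \<omega> n = k}) \<le> C"
proof -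
  define N where "N = {\<omega> \<in> space S. \<forall>m. pos G \<omega> (Suc m) \<noteq> \<one>}"
  define L where "L k n = {\<omega> \<in> space S. pos G \<omega> n = k \<and> (\<forall>m. pos G \<omega> (n + Suc m) \<noteq> k)}" for k n
  define V where "V k n = {\<omega> \<in> space S. pos G \<omega> n = k}" for k n
  have vm: "V k n \<in> sets S" for k n
    unfolding V_def by measurable
  have nm: "N \<in> sets S"
    unfolding N_def by measurable
  have lm: "L k n \<in> sets S" for k n
    unfolding L_def by measurable
  have L: "emeasure S (L k n) = emeasure S (V k n) * emeasure S N" if "k \<in> carrier G" for k n
  proof (rule emeasure_comb_seq[OF lm vm nm, of n])
    fix \<omega> \<omega>' assume \<omega>: "\<omega> \<in> space S" "\<omega>' \<in> space S"
    have "comb_seq n \<omega> \<omega>' \<in> space S"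
      using \<omega> by (auto simp: space_PiM PiE_iff comb_seq_def)
    moreover have "k \<otimes> g = k \<longleftrightarrow> g = \<one>" if "g \<in> carrier G" for g
      using \<open>k \<in> carrier G\<close> that by simp
    ultimately show "comb_seq n \<omega> \<omega>' \<in> L k n \<longleftrightarrow> \<omega> \<in> V k n \<and> \<omega>' \<in> N"
      using \<omega> pos_closed[of \<omega>'] in_carrier[OF \<omega>(2)]
      by (auto simp: L_def V_def N_def pos_comb_seq simp del: pos.simps add_Suc_right)
  qed
  have disj: "disjoint_family (L k)" for k
    unfolding disjoint_family_on_def
  proof safe
    fix m n \<omega> assume *: "m \<noteq> n" "\<omega> \<in> L k m" "\<omega> \<in> L k n"
    have False if "i < j" "\<omega> \<in> L k i" "\<omega> \<in> L k j" for i j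
    proof -
      obtain d where "j = i + Suc d"
        using \<open>i < j\<close> less_imp_Suc_add by fastforce
      with that show False
        by (auto simp: L_def simp del: pos.simps add_Suc_right)
    qed
    with * show "\<omega> \<in> {}"
      by (metis nat_neq_iff)
  qed
  have bound: "(\<Sum>n. emeasure S (V k n)) * emeasure S N \<le> 1" if "k \<in> carrier G" for k
  proof -
    have "(\<Sum>n. emeasure S (V k n)) * emeasure S N = (\<Sum>n. emeasure S (L k n))"
      using L[OF that] by simp
    also have "\<dots> = emeasure S (\<Union>n. L k n)"
      using lm disj by (intro suminf_emeasure) auto
    also have "\<dots> \<le> 1"
      by (rule P.emeasure_le_1)
    finally show ?thesis .
  qed
  have pos: "emeasure S N \<noteq> 0"
  proof
    assume "emeasure S N = 0"
    then have "L \<one> n \<in> null_sets S" for n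
      using L[of \<one> n] lm by auto
    then have "AE \<omega> in S. \<omega> \<notin> L \<one> n" for n
      by (rule AE_not_in)
    then have 1: "AE \<omega> in S. \<forall>n. \<omega> \<notin> L \<one> n"
      by (simp add: AE_all_countable)
    have "AE \<omega> in S. finite {n. pos G \<omega> (Suc n) = \<one>}"
      using assms unfolding transient_walk_def by (rule AE_walk_lawD)
    with 1 AE_space have "AE \<omega> in S. False"
    proof eventually_elim
      case (elim \<omega>)
      let ?T = "{n. pos G \<omega> n = \<one>}"
      \<comment> \<open>Transience only counts visits from time 1 on. Adding the visit at time 0
        keeps the set finite and makes it nonempty, so a last visit exists.\<close>
      have "?T \<subseteq> insert 0 (Suc ` {n. pos G \<omega> (Suc n) = \<one>})"
      proof
        fix n assume "n \<in> ?T"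
        then show "n \<in> insert 0 (Suc ` {n. pos G \<omega> (Suc n) = \<one>})"
          by (cases n) auto
      qed
      then have fin: "finite ?T"
        using elim by (meson finite_imageI finite_insert finite_subset)
      moreover have "0 \<in> ?T" by simp
      ultimately have m: "Max ?T \<in> ?T"
        by (metis Max_in empty_iff)
      have "pos G \<omega> (Max ?T + Suc m) \<noteq> \<one>" for m
      proof
        assume "pos G \<omega> (Max ?T + Suc m) = \<one>"
        then have "Max ?T + Suc m \<le> Max ?T"
          using fin by (intro Max_ge) auto
        then show False by simp
      qed
      then have "\<omega> \<in> L \<one> (Max ?T)"
        using m elim by (simp add: L_def del: pos.simps add_Suc_right)
      with elim show ?case by blast
    qed
    then show False
      by simp
  qed
  show thesis
  proof
    show "1 / emeasure S N < \<infinity>"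
      using pos by (simp add: ennreal_divide_eq_top_iff less_top[symmetric])
    show "(\<Sum>n. emeasure S {\<omega> \<in> space S. pos G \<omega> n = k}) \<le> 1 / emeasure S N"
      if "k \<in> carrier G" for k
      using pos divide_right_mono_ennreal[OF bound[OF that], of "emeasure S N"]
      by (simp add: ennreal_mult_divide_eq P.emeasure_eq_measure flip: V_def)
  qed
qed

end

section \<open>Walks on the shuffler group\<close>

lemma Shuffler_mult:
  "p \<otimes>\<^bsub>Shuffler H\<^esub> q = (fst p \<circ> FSym_act H (snd p) (fst q), snd p \<otimes>\<^bsub>H\<^esub> snd q)"
  by (auto simp: Shuffler_def FSym_def split: prod.split)

lemma Shuffler_carrier:
  "p \<in> carrier (Shuffler H) \<longleftrightarrow>
    fst p permutes carrier H \<and> finite (supp H (fst p)) \<and> snd p \<in> carrier H"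
  by (cases p) (auto simp: Shuffler_def FSym_def)

lemma snd_pos_Shuffler: "snd (pos (Shuffler H) \<omega> n) = pos H (\<lambda>i. snd (\<omega> i)) n"
  by (induction n) (auto simp: Shuffler_mult, simp add: Shuffler_def)

locale shuffler_walk = H: group H for H (structure) +
  fixes \<mu> :: "(('a \<Rightarrow> 'a) \<times> 'a) measure"
  assumes countable_H: "countable (carrier H)"
    and prob_measure_Shuffler: "prob_measure_on (Shuffler H) \<mu>"
begin

sublocale W: random_walk "Shuffler H" \<mu>
  using group_Shuffler[OF H.is_group] countable_Shuffler[OF countable_H] prob_measure_Shuffler
  by (intro random_walk.intro random_walk_axioms.intro)

sublocale R: random_walk H "induced_measure H \<mu>"
  using H.is_group countable_H prob_measure_on_induced_measure[OF prob_measure_Shuffler]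
  by (intro random_walk.intro random_walk_axioms.intro)

lemma snd_measurable [measurable]: "snd \<in> measurable \<mu> (count_space (carrier H))"
  by (auto simp: W.measurable_M Shuffler_carrier)

text \<open>Transfers the Green bound from the space of \<open>H\<close>-increments to the second
  coordinate of the shuffler walk.\<close>

lemma emeasure_snd_pos:
  "emeasure W.S {\<omega> \<in> space W.S. snd (pos (Shuffler H) \<omega> n) = k}
    = emeasure R.S {\<omega> \<in> space R.S. pos H \<omega> n = k}"
proof -
  let ?f = "\<lambda>\<omega> (n::nat). snd (\<omega> n) :: 'a"
  have d: "distr W.S R.S ?f = R.S"
    unfolding induced_measure_def
    by (rule distr_PiM_UNIV) (simp_all add: W.prob_space snd_measurable)
  have f: "?f \<in> measurable W.S R.S"
    by (intro measurable_PiM_single')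
      (auto simp: space_PiM R.measurable_count_space_M R.space_M W.space_M Shuffler_carrier PiE_iff)
  have "emeasure R.S {\<omega> \<in> space R.S. pos H \<omega> n = k}
      = emeasure (distr W.S R.S ?f) {\<omega> \<in> space R.S. pos H \<omega> n = k}"
    by (simp only: d)
  also have "\<dots> = emeasure W.S (?f -` {\<omega> \<in> space R.S. pos H \<omega> n = k} \<inter> space W.S)"
    by (rule emeasure_distr[OF f]) measurable
  also have "?f -` {\<omega> \<in> space R.S. pos H \<omega> n = k} \<inter> space W.S
      = {\<omega> \<in> space W.S. snd (pos (Shuffler H) \<omega> n) = k}"
    using measurable_space[OF f] by (auto simp: snd_pos_Shuffler)
  finally show ?thesis ..
qed

section \<open>Almost sure pointwise stabilisation of the permutations\<close>

text \<open>Tonelli: for a fixed permutation, the sum over \<open>s\<close> of the indicators counts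
  its support.\<close>

lemma sum_displacement_prob:
  "(\<integral>\<^sup>+ s. emeasure \<mu> {p \<in> space \<mu>. s \<in> supp H (fst p)} \<partial>count_space (carrier H))
    = (\<integral>\<^sup>+ (f, y). of_nat (card (supp H f)) \<partial>\<mu>)"
proof -
  have "(\<integral>\<^sup>+ s. emeasure \<mu> {p \<in> space \<mu>. s \<in> supp H (fst p)} \<partial>count_space (carrier H))
      = (\<integral>\<^sup>+ s. \<integral>\<^sup>+ p. indicator {p \<in> space \<mu>. s \<in> supp H (fst p)} p \<partial>\<mu> \<partial>count_space (carrier H))"
    by (intro nn_integral_cong nn_integral_indicator[symmetric]) (auto simp: W.sets_M W.space_M)
  also have "\<dots> = (\<integral>\<^sup>+ p. \<integral>\<^sup>+ s. indicator {p \<in> space \<mu>. s \<in> supp H (fst p)} p \<partial>count_space (carrier H) \<partial>\<mu>)"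
    using countable_H
    by (intro nn_integral_count_space_nn_integral[symmetric]) (auto simp: W.measurable_M)
  also have "\<dots> = (\<integral>\<^sup>+ p. of_nat (card (supp H (fst p))) \<partial>\<mu>)"
  proof (rule nn_integral_cong)
    fix p assume p: "p \<in> space \<mu>"
    then have "finite (supp H (fst p))"
      by (simp add: W.space_M Shuffler_carrier)
    moreover have "(\<integral>\<^sup>+ s. indicator {p \<in> space \<mu>. s \<in> supp H (fst p)} p \<partial>count_space (carrier H))
        = (\<integral>\<^sup>+ s. indicator (supp H (fst p)) s \<partial>count_space (carrier H))"
      using p by (intro nn_integral_cong) (simp add: indicator_def)
    moreover have "supp H (fst p) \<subseteq> carrier H"
      by (auto simp: supp_def)
    ultimately show "(\<integral>\<^sup>+ s. indicator {p \<in> space \<mu>. s \<in> supp H (fst p)} p \<partial>count_space (carrier H))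
        = of_nat (card (supp H (fst p)))"
      by simp
  qed
  finally show ?thesis
    by (simp add: split_beta')
qed

text \<open>The permutation \<open>y \<cdot> f\<close> moves \<open>h\<close> exactly when
  \<open>y\<^sup>-\<^sup>1 h\<close> lies in the support of \<open>f\<close>, so these are the times
  when the new increment can change the image of \<open>h\<close>. Their probabilities are summable,
  and Borel-Cantelli applies.\<close>

lemma AE_eventually_no_displacement:
  assumes "transient_walk H (induced_measure H \<mu>)"
    and "(\<integral>\<^sup>+ (f, y). of_nat (card (supp H f)) \<partial>\<mu>) < \<infinity>"
    and h: "h \<in> carrier H"
  shows "AE \<omega> in W.S. \<forall>\<^sub>F n in sequentially.
    inv (snd (pos (Shuffler H) \<omega> n)) \<otimes> h \<notin> supp H (fst (\<omega> n))"
proof -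
  obtain C :: ennreal where C: "C < \<infinity>"
    and Green: "\<And>k. k \<in> carrier H \<Longrightarrow> (\<Sum>n. emeasure R.S {\<omega> \<in> space R.S. pos H \<omega> n = k}) \<le> C"
    using R.transient_Green_bound[OF assms(1)] by blast
  define V where "V k n = {\<omega> \<in> space W.S. snd (pos (Shuffler H) \<omega> n) = k}" for k n
  define D where "D s = {p \<in> space \<mu>. s \<in> supp H (fst p)}" for s
  define A where "A n k = {\<omega> \<in> V k n. \<omega> n \<in> D (inv k \<otimes> h)}" for n k
  define B where
    "B n = {\<omega> \<in> space W.S. inv (snd (pos (Shuffler H) \<omega> n)) \<otimes> h \<in> supp H (fst (\<omega> n))}" for n
  have sp: "snd (pos (Shuffler H) \<omega> n) \<in> carrier H" if "\<omega> \<in> space W.S" for \<omega> n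
    using W.pos_closed[of \<omega> n] W.in_carrier[OF that] by (simp add: Shuffler_carrier)
  have D: "D s \<in> sets \<mu>" for s
    by (auto simp: D_def W.sets_M W.space_M)
  have Dm: "{\<omega> \<in> space W.S. \<omega> n \<in> D s} \<in> sets W.S" for n s
    using D by measurable
  have V: "V k n \<in> sets W.S" for k n
  proof -
    have "V k n = (\<lambda>\<omega>. pos (Shuffler H) \<omega> n) -` {p \<in> carrier (Shuffler H). snd p = k} \<inter> space W.S"
      using W.pos_closed W.in_carrier by (auto simp: V_def)
    then show ?thesis
      by (simp only:) (rule measurable_sets[OF W.pos_measurable], auto)
  qed
  have A: "A n k \<in> sets W.S" for n k
  proof -
    have "A n k = V k n \<inter> {\<omega> \<in> space W.S. \<omega> n \<in> D (inv k \<otimes> h)}"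
      by (auto simp: A_def V_def)
    then show ?thesis
      using V Dm by simp
  qed
  have emA: "emeasure W.S (A n k) = emeasure W.S (V k n) * emeasure \<mu> (D (inv k \<otimes> h))" for n k
  proof -
    \<comment> \<open>The position at time \<open>n\<close> uses only increments before
      \<open>n\<close>, and entry \<open>n\<close> of the spliced sequence is entry 0 of the second
      one; hence the two factors.\<close>
    have "emeasure W.S (A n k)
        = emeasure W.S (V k n) * emeasure W.S {\<omega> \<in> space W.S. \<omega> 0 \<in> D (inv k \<otimes> h)}"
    proof (rule W.emeasure_comb_seq[OF A V Dm, of n])
      fix \<omega> \<omega>' assume \<omega>: "\<omega> \<in> space W.S" "\<omega>' \<in> space W.S"
      have "comb_seq n \<omega> \<omega>' \<in> space W.S"
        using \<omega> by (auto simp: space_PiM PiE_iff comb_seq_def)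
      then show "comb_seq n \<omega> \<omega>' \<in> A n k
          \<longleftrightarrow> \<omega> \<in> V k n \<and> \<omega>' \<in> {\<omega> \<in> space W.S. \<omega> 0 \<in> D (inv k \<otimes> h)}"
        using \<omega> by (auto simp: A_def V_def W.pos_comb_seq comb_seq_def)
    qed
    also have "emeasure W.S {\<omega> \<in> space W.S. \<omega> 0 \<in> D (inv k \<otimes> h)} = emeasure \<mu> (D (inv k \<otimes> h))"
      by (rule W.emeasure_PiM_Collect_single) (simp_all add: D)
    finally show ?thesis .
  qed
  have B_eq: "B n = (\<Union>k\<in>carrier H. A n k)" for n
    using sp W.in_carrier by (auto simp: B_def A_def V_def D_def W.space_M)
  have B: "B n \<in> sets W.S" for n
    unfolding B_eq using A countable_H by (intro sets.countable_UN') auto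
  have "(\<Sum>n. emeasure W.S (B n))
      = (\<Sum>n. \<integral>\<^sup>+ k. emeasure W.S (V k n) * emeasure \<mu> (D (inv k \<otimes> h)) \<partial>count_space (carrier H))"
    unfolding B_eq emA[symmetric] using countable_H A
    by (subst emeasure_UN_countable) (auto simp: disjoint_family_on_def A_def V_def)
  also have "\<dots> = (\<integral>\<^sup>+ k. (\<Sum>n. emeasure W.S (V k n)) * emeasure \<mu> (D (inv k \<otimes> h)) \<partial>count_space (carrier H))"
    by (simp add: nn_integral_suminf[symmetric])
  \<comment> \<open>The Green bound enters here; its uniformity in \<open>k\<close> lets
    \<open>C\<close> leave the integral.\<close>
  also have "\<dots> \<le> (\<integral>\<^sup>+ k. C * emeasure \<mu> (D (inv k \<otimes> h)) \<partial>count_space (carrier H))"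
    using Green by (intro nn_integral_mono mult_right_mono) (auto simp: V_def emeasure_snd_pos)
  also have "\<dots> = C * (\<integral>\<^sup>+ k. emeasure \<mu> (D (inv k \<otimes> h)) \<partial>count_space (carrier H))"
    by (simp add: nn_integral_cmult)
  \<comment> \<open>Substitution \<open>s = k\<^sup>-\<^sup>1 h\<close>, a bijection of
    \<open>H\<close> with inverse map \<open>s \<mapsto> h s\<^sup>-\<^sup>1\<close>.\<close>
  also have "(\<integral>\<^sup>+ k. emeasure \<mu> (D (inv k \<otimes> h)) \<partial>count_space (carrier H))
      = (\<integral>\<^sup>+ s. emeasure \<mu> (D s) \<partial>count_space (carrier H))"
  proof (intro nn_integral_bij_count_space bij_betwI[where g = "\<lambda>s. h \<otimes> inv s"])
    show "h \<otimes> inv (inv k \<otimes> h) = k" if "k \<in> carrier H" for k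
      using that h by (simp add: H.inv_mult_group flip: H.m_assoc)
    show "inv (h \<otimes> inv s) \<otimes> h = s" if "s \<in> carrier H" for s
      using that h by (simp add: H.inv_mult_group H.m_assoc)
  qed (use h in auto)
  also have "\<dots> = (\<integral>\<^sup>+ (f, y). of_nat (card (supp H f)) \<partial>\<mu>)"
    unfolding D_def by (rule sum_displacement_prob)
  also have "C * \<dots> < \<infinity>"
    using C assms(2) by (simp add: ennreal_mult_less_top)
  finally have "(\<Sum>n. ennreal (measure W.S (B n))) \<noteq> \<infinity>"
    by (simp add: W.P.emeasure_eq_measure)
  then have "summable (\<lambda>n. measure W.S (B n))"
    by (intro summable_suminf_not_top) auto
  then have "AE \<omega> in W.S. \<forall>\<^sub>F n in sequentially. \<omega> \<in> space W.S - B n"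
    by (intro borel_cantelli_AE1 B) (simp_all add: W.P.emeasure_eq_measure)
  then show ?thesis
  proof eventually_elim
    case (elim \<omega>)
    then show ?case
      by eventually_elim (simp add: B_def)
  qed
qed

text \<open>After the last displacement time each new factor fixes \<open>h\<close>, and it is
  applied before the permutation accumulated so far; the image of \<open>h\<close> thus stays
  constant.\<close>

lemma AE_pointwise_stabilisation:
  assumes "transient_walk H (induced_measure H \<mu>)"
    and "(\<integral>\<^sup>+ (f, y). of_nat (card (supp H f)) \<partial>\<mu>) < \<infinity>"
    and h: "h \<in> carrier H"
  shows "AE \<omega> in W.S. \<exists>k\<in>carrier H. \<forall>\<^sub>F n in sequentially. fst (pos (Shuffler H) \<omega> n) h = k"
  using AE_eventually_no_displacement[OF assms] AE_space
proof eventually_elim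
  case (elim \<omega>)
  let ?x = "pos (Shuffler H) \<omega>"
  have x: "?x n \<in> carrier (Shuffler H)" for n
    using W.pos_closed W.in_carrier elim by blast
  obtain N where N: "\<And>n. n \<ge> N \<Longrightarrow> inv (snd (?x n)) \<otimes> h \<notin> supp H (fst (\<omega> n))"
    using elim by (auto simp: eventually_sequentially)
  have "fst (?x n) h = fst (?x N) h" if "n \<ge> N" for n
    using that
  proof (induction n rule: dec_induct)
    case (step n)
    have y: "snd (?x n) \<in> carrier H"
      using x by (simp add: Shuffler_carrier)
    then have "fst (\<omega> n) (inv (snd (?x n)) \<otimes> h) = inv (snd (?x n)) \<otimes> h"
      using N[OF step(1)] h by (auto simp: supp_def)
    then have "FSym_act H (snd (?x n)) (fst (\<omega> n)) h = h"
      using y h by (simp add: FSym_act_def H.m_assoc[symmetric])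
    then show ?case
      using step.IH by (simp add: Shuffler_mult)
  qed simp
  moreover have "fst (?x N) h \<in> carrier H"
    using x h by (simp add: Shuffler_carrier permutes_in_image)
  ultimately show ?case
    unfolding eventually_sequentially by blast
qed

section \<open>Triviality of the boundary forces a deterministic limit\<close>

text \<open>Dropping one term does not affect an eventual property, so the event is invariant in the
  strict sense.\<close>

lemma limit_event_invariant:
  "{x \<in> space (path_space (Shuffler H)). \<forall>\<^sub>F n in sequentially. fst (x n) h = k}
    \<in> shift_invariant_events (Shuffler H)"
    (is "?A \<in> _")
proof -
  let ?P = "path_space (Shuffler H)"
  have m: "(\<lambda>x. x n) \<in> measurable ?P (count_space (carrier (Shuffler H)))" for n
    unfolding path_space_def by measurable
  have "{x \<in> space ?P. fst (x n) h = k} \<in> sets ?P" for n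
  proof -
    have "{x \<in> space ?P. fst (x n) h = k}
        = (\<lambda>x. x n) -` {p \<in> carrier (Shuffler H). fst p h = k} \<inter> space ?P"
      using measurable_space[OF m] by auto
    then show ?thesis
      by (simp only:) (rule measurable_sets[OF m], auto)
  qed
  then have "?A \<in> sets ?P"
    unfolding eventually_sequentially
    by (intro sets.sets_Collect_countable_Ex sets.sets_Collect_countable_All sets.sets_Collect_imp) auto
  moreover have "shift x \<in> space ?P" if "x \<in> space ?P" for x
    using that by (auto simp: shift_def path_space_def space_PiM)
  then have "shift -` ?A \<inter> space ?P = ?A"
    by (auto simp: shift_def eventually_sequentially_Suc[of "\<lambda>n. fst (_ n) h = k"])
  ultimately show ?thesis
    by (simp add: shift_invariant_events_def)
qed

text \<open>The limit of the images of \<open>h\<close> takes values in a countable set and each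
  level set has probability 0 or 1. Since the limit exists almost surely, the level sets cannot all
  be null.\<close>

lemma trivial_imp_deterministic_limit:
  assumes "transient_walk H (induced_measure H \<mu>)"
    and "(\<integral>\<^sup>+ (f, y). of_nat (card (supp H f)) \<partial>\<mu>) < \<infinity>"
    and triv: "trivial_Poisson_boundary (Shuffler H) \<mu>"
    and h: "h \<in> carrier H"
  shows "\<exists>k\<in>carrier H. AE \<omega> in W.S. \<forall>\<^sub>F n in sequentially. fst (pos (Shuffler H) \<omega> n) h = k"
proof -
  let ?P = "path_space (Shuffler H)" and ?L = "walk_law (Shuffler H) \<mu>"
  interpret L: prob_space ?L
    by (rule prob_space_walk_law[OF W.is_group W.countable_carrier W.prob_measure])
  have spL: "space ?L = space ?P" "sets ?L = sets ?P"
    by (simp_all add: walk_law_def)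
  define A where "A k = {x \<in> space ?P. \<forall>\<^sub>F n in sequentially. fst (x n) h = k}" for k
  have inv: "A k \<in> shift_invariant_events (Shuffler H)" for k
    unfolding A_def by (rule limit_event_invariant)
  then have A: "A k \<in> sets ?L" for k
    by (simp add: shift_invariant_events_def spL)
  have ev: "(\<forall>\<^sub>F n in sequentially. fst (pos (Shuffler H) \<omega> (Suc n)) h = k)
      \<longleftrightarrow> (\<forall>\<^sub>F n in sequentially. fst (pos (Shuffler H) \<omega> n) h = k)" for \<omega> k
    by (rule eventually_sequentially_Suc)
  have "\<exists>k\<in>carrier H. measure ?L (A k) = 1"
  proof (rule ccontr)
    assume "\<not> ?thesis"
    then have "measure ?L (A k) = 0" if "k \<in> carrier H" for k
      using triv inv that unfolding trivial_Poisson_boundary_def by blast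
    then have "AE x in ?L. x \<notin> A k" if "k \<in> carrier H" for k
      using A that by (intro AE_not_in) (auto simp: L.emeasure_eq_measure null_sets_def)
    then have "AE x in ?L. \<forall>k\<in>carrier H. x \<notin> A k"
      using countable_H by (simp add: AE_ball_countable)
    then have "AE x in ?L. \<forall>k\<in>carrier H. \<not> (\<forall>\<^sub>F n in sequentially. fst (x n) h = k)"
      using AE_space by eventually_elim (simp add: A_def spL)
    from W.AE_walk_lawD[OF this] AE_pointwise_stabilisation[OF assms(1,2) h]
    have "AE \<omega> in W.S. False"
      by eventually_elim (simp only: ev, blast)
    then show False by simp
  qed
  then obtain k where k: "k \<in> carrier H" "measure ?L (A k) = 1"
    by blast
  then have "AE x in ?L. x \<in> A k"
    by (simp add: L.AE_in_set_eq_1 A)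
  then have "AE x in ?L. \<forall>\<^sub>F n in sequentially. fst (x n) h = k"
    by (rule AE_mp) (simp add: A_def)
  from W.AE_walk_lawD[OF this] show ?thesis
    using k unfolding ev by blast
qed

text \<open>A deterministic limit \<open>\<phi>\<close> is fixed by every increment \<open>(f, y)\<close> of positive probability:
  deleting the first increment yields a walk whose limit \<open>\<psi>\<close> satisfies \<open>\<phi> = f \<circ> (y \<cdot> \<psi>)\<close>, and \<open>\<psi> = \<phi>\<close>
  almost surely.\<close>

lemma deterministic_limit_fixed:
  assumes lim: "\<And>h. h \<in> carrier H \<Longrightarrow>
      AE \<omega> in W.S. \<forall>\<^sub>F n in sequentially. fst (pos (Shuffler H) \<omega> n) h = \<phi> h"
    and p: "p \<in> msupport \<mu>" and h: "h \<in> carrier H"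
  shows "fst p (snd p \<otimes> \<phi> (inv (snd p) \<otimes> h)) = \<phi> h"
proof (rule ccontr)
  assume neq: "\<not> ?thesis"
  have pc: "p \<in> carrier (Shuffler H)" and pos: "measure \<mu> {p} > 0"
    using p by (auto simp: msupport_def W.space_M)
  then have y: "snd p \<in> carrier H"
    by (simp add: Shuffler_carrier)
  then have h': "inv (snd p) \<otimes> h \<in> carrier H"
    using h by simp
  \<comment> \<open>If the first increment were \<open>p\<close>, the limits of the walk at
    \<open>h\<close> and of the shifted walk at \<open>inv (snd p) \<otimes> h\<close> would give
    the denied equation. Avoiding \<open>p\<close> almost surely contradicts its positive
    mass.\<close>
  have "AE \<omega> in W.S. \<omega> 0 \<noteq> p"
    using lim[OF h] W.AE_shift[OF lim[OF h']] AE_space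
  proof eventually_elim
    case (elim \<omega>)
    show ?case
    proof
      assume \<omega>0: "\<omega> 0 = p"
      have "fst (pos (Shuffler H) \<omega> (Suc n)) h
          = fst p (snd p \<otimes> fst (pos (Shuffler H) (shift \<omega>) n) (inv (snd p) \<otimes> h))" for n
        using W.pos_Suc_shift[OF W.in_carrier[OF elim(3)]] h \<omega>0
        by (simp add: Shuffler_mult FSym_act_def del: pos.simps)
      moreover have "\<forall>\<^sub>F n in sequentially. fst (pos (Shuffler H) \<omega> (Suc n)) h = \<phi> h"
        using elim(1) by (rule eventually_sequentially_Suc[THEN iffD2])
      ultimately have "\<forall>\<^sub>F n in sequentially.
          fst p (snd p \<otimes> fst (pos (Shuffler H) (shift \<omega>) n) (inv (snd p) \<otimes> h)) = \<phi> h"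
        by simp
      with elim(2) have "\<forall>\<^sub>F n::nat in sequentially. fst p (snd p \<otimes> \<phi> (inv (snd p) \<otimes> h)) = \<phi> h"
        by eventually_elim simp
      with neq show False by simp
    qed
  qed
  moreover have "{p} \<in> sets \<mu>"
    using pc by (simp add: W.sets_M)
  then have "emeasure W.S {\<omega> \<in> space W.S. \<omega> 0 \<in> {p}} = emeasure \<mu> {p}"
    by (intro W.emeasure_PiM_Collect_single) simp_all
  then have "emeasure W.S {\<omega> \<in> space W.S. \<not> \<omega> 0 \<noteq> p} \<noteq> 0"
    using pos by (simp add: W.M.emeasure_eq_measure)
  moreover have "{\<omega> \<in> space W.S. \<not> \<omega> 0 \<noteq> p} \<in> sets W.S"
    by measurable
  ultimately show False
    by (simp add: AE_iff_measurable[OF _ refl])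
qed

section \<open>From the support of the measure to the whole group\<close>

text \<open>The equation says that \<open>(f, y)\<close> fixes \<phi> under
  \<open>(f, y) \<cdot> \<phi> = f \<circ> (y \<cdot> \<phi>)\<close>. This is compatible with
  products, so the elements fixing \<phi> are closed under multiplication. Carrier membership joins
  the induction because the cancellations in \<open>H\<close> require it.\<close>

lemma fixed_by_semigroup_span:
  assumes \<phi>: "\<And>h. h \<in> carrier H \<Longrightarrow> \<phi> h \<in> carrier H"
    and fixed: "\<And>p h. p \<in> T \<Longrightarrow> h \<in> carrier H \<Longrightarrow> fst p (snd p \<otimes> \<phi> (inv (snd p) \<otimes> h)) = \<phi> h"
    and T: "T \<subseteq> carrier (Shuffler H)"
    and p: "p \<in> semigroup_span (Shuffler H) T"
  shows "p \<in> carrier (Shuffler H) \<and>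
    (\<forall>h\<in>carrier H. fst p (snd p \<otimes> \<phi> (inv (snd p) \<otimes> h)) = \<phi> h)"
  using p
proof induction
  case (base p)
  then show ?case using fixed T by blast
next
  case (mult p q)
  then have c: "snd p \<in> carrier H" "snd q \<in> carrier H"
    by (auto simp: Shuffler_carrier)
  have "fst (p \<otimes>\<^bsub>Shuffler H\<^esub> q)
      (snd (p \<otimes>\<^bsub>Shuffler H\<^esub> q) \<otimes> \<phi> (inv (snd (p \<otimes>\<^bsub>Shuffler H\<^esub> q)) \<otimes> h)) = \<phi> h"
    if h: "h \<in> carrier H" for h
  proof -
    have h': "inv (snd p) \<otimes> h \<in> carrier H" "inv (snd q) \<otimes> (inv (snd p) \<otimes> h) \<in> carrier H"
      using c h by simp_all
    have "inv (snd p \<otimes> snd q) \<otimes> h = inv (snd q) \<otimes> (inv (snd p) \<otimes> h)"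
      using c h by (simp add: H.inv_mult_group H.m_assoc)
    moreover have "inv (snd p) \<otimes> (snd p \<otimes> snd q \<otimes> g) = snd q \<otimes> g" if "g \<in> carrier H" for g
      using c that by (simp add: H.m_assoc[symmetric])
    ultimately show ?thesis
      using mult.IH c h h' \<phi> by (simp add: Shuffler_mult FSym_act_def)
  qed
  then show ?case
    using mult.IH by simp
qed

text \<open>On a one-element group the walk is always at the identity. The result supplies a second
  point for the final transposition.\<close>

lemma transient_imp_nontrivial:
  assumes "transient_walk H (induced_measure H \<mu>)"
  shows "carrier H \<noteq> {k}"
proof
  assume "carrier H = {k}"
  then have c: "carrier H = {\<one>}"
    using H.one_closed by auto
  have "AE \<omega> in R.S. finite {n. pos H \<omega> (Suc n) = \<one>}"
    using assms unfolding transient_walk_def by (rule R.AE_walk_lawD)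
  then have "AE \<omega> in R.S. False"
    using AE_space
  proof eventually_elim
    case (elim \<omega>)
    have "pos H \<omega> (Suc n) = \<one>" for n
      using R.pos_closed[of \<omega> "Suc n"] R.in_carrier[OF elim(2)] c by blast
    with elim show ?case by (simp del: pos.simps)
  qed
  then show False by simp
qed

end

theorem corollary4p6:
  fixes H :: "('a, 'b) monoid_scheme" and \<mu> :: "(('a \<Rightarrow> 'a) \<times> 'a) measure"
  assumes "group H" and "countable (carrier H)"
    and "prob_measure_on (Shuffler H) \<mu>"
    and "nondegenerate (Shuffler H) \<mu>"
    and "transient_walk H (induced_measure H \<mu>)"
    and "(\<integral>\<^sup>+ (f, y). of_nat (card (supp H f)) \<partial>\<mu>) < \<infinity>"
  shows "\<not> trivial_Poisson_boundary (Shuffler H) \<mu>"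
proof
  assume triv: "trivial_Poisson_boundary (Shuffler H) \<mu>"
  interpret shuffler_walk H \<mu>
    using assms by (intro shuffler_walk.intro shuffler_walk_axioms.intro)
  obtain \<phi> where \<phi>: "\<And>h. h \<in> carrier H \<Longrightarrow> \<phi> h \<in> carrier H"
    and lim: "\<And>h. h \<in> carrier H \<Longrightarrow>
      AE \<omega> in W.S. \<forall>\<^sub>F n in sequentially. fst (pos (Shuffler H) \<omega> n) h = \<phi> h"
    using trivial_imp_deterministic_limit[OF assms(5,6) triv] by metis
  have span: "semigroup_span (Shuffler H) (msupport \<mu>) = carrier (Shuffler H)"
    using assms(4) by (simp add: nondegenerate_def)
  have T: "msupport \<mu> \<subseteq> carrier (Shuffler H)"
    by (auto simp: msupport_def W.space_M)
  have fixed: "fst p (snd p \<otimes>\<^bsub>H\<^esub> \<phi> (inv\<^bsub>H\<^esub> (snd p) \<otimes>\<^bsub>H\<^esub> h)) = \<phi> h"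
    if "p \<in> carrier (Shuffler H)" "h \<in> carrier H" for p h
    using fixed_by_semigroup_span[OF \<phi> deterministic_limit_fixed[OF lim] T] that span by blast
  let ?a = "\<phi> \<one>\<^bsub>H\<^esub>"
  have a: "?a \<in> carrier H"
    using \<phi> by simp
  then obtain b where b: "b \<in> carrier H" "b \<noteq> ?a"
    using transient_imp_nontrivial[OF assms(5)] by blast
  have "supp H (Transposition.transpose ?a b) \<subseteq> {?a, b}"
    by (auto simp: supp_def Transposition.transpose_def)
  then have "(Transposition.transpose ?a b, \<one>\<^bsub>H\<^esub>) \<in> carrier (Shuffler H)"
    using a b permutes_swap_id[of ?a "carrier H" b] finite_subset
    by (auto simp: Shuffler_carrier)
  from fixed[OF this H.one_closed] show False
    using a b by simp
qed

end
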